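(* Let $\mathbb{K}$ be a field of characteristic zero, let $A\in\mathbb{K}^{n\times n}$, and suppose that the irreducible factorization $\chi_A(\lambda)=f_1(\lambda)^{m_1}\cdots f_q(\lambda)^{m_q}$ of its characteristic polynomial is given. Then Algorithm P (described in the context) outputs all unit pseudo annihilating polynomials $\pi'_{A,1}(\lambda),\ldots,\pi'_{A,n}(\lambda)$ for the matrix $A$ (i.e. their exponents $\rho_{i,j}$) with $$O\left((q-1)n^3+n^2\deg(\pi_A(\lambda))\right)$$ arithmetic operations in $\mathbb{K}$, where $\pi_A(\lambda)$ is the minimal polynomial of $A$.
   Context: Setting. $f_1,\ldots,f_q$ are the pairwise distinct monic irreducible factors of $\chi_A$ over $\mathbb{K}$, $m_p\ge1$, $F_p=f_p(A)$, $g_p(\lambda)=\chi_A(\lambda)/f_p(\lambda)^{m_p}$. Cost model. Time is counted in arithmetic operations in $\mathbb{K}$; the factorization of $\chi_A$ is assumed given. A product $\bm{w}f(A)$ of a row vector with $f(A)$, $\deg f=d$, is computed by Horner's rule with vector-matrix products, at cost $O(n^2d)$. Pseudo annihilating polynomials. For a nonzero row vector $\bm{u}\in\mathbb{K}^n$ let $w_{i,j}^{(k)}$ be the $j$-th entry of $\bm{u}g_i(A)F_i^k$ ($k\ge0$) and let $\rho_{i,j}$ be the smallest $k\ge0$ with $w_{i,j}^{(k)}=0$. The $j$-th unit pseudo annihilating polynomial (with respect to $\bm{u}$) is $\pi'_{A,j}=\prod_{i=1}^q f_i^{\rho_{i,j}}$. Algorithm P. Generate a random row vector $\bm{u}$.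 For $i=1,\ldots,q$: compute $g_i=\chi_A/f_i^{m_i}$ and $\bar{\bm{b}}=\bm{u}g_i(A)$ by Horner's rule; then for $k=0,1,\ldots,m_i-1$, for every $j$ whose exponent $\rho_{i,j}$ has not yet been set and for which the $j$-th entry of $\bar{\bm{b}}$ is $0$, set $\rho_{i,j}=k$, and then replace $\bar{\bm{b}}$ by $\bar{\bm{b}}f_i(A)$ (this loop is left as soon as, at the start of a pass, $\bar{\bm{b}}=\bm{0}$ and all $\rho_{i,j}$, $1\le j\le n$, are set); finally set every still unset $\rho_{i,j}$ to $m_i$. Output $(\rho_{i,j})$. *)

theory Defs
  imports "Jordan_Normal_Form.Char_Poly" "HOL-Library.State_Monad"
begin

section \<open>Polynomials in a matrix\<close>

text \<open>\<open>f(A)\<close> for a square matrix \<open>A\<close>, written entrywise because matrices of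
  variable dimension do not form an instance of a class with sums.\<close>
definition mat_poly :: "'a::field poly \<Rightarrow> 'a mat \<Rightarrow> 'a mat" where
  "mat_poly f A = mat (dim_row A) (dim_row A)
     (\<lambda>(i, j). \<Sum>k\<le>degree f. coeff f k * (A ^\<^sub>m k) $$ (i, j))"

definition min_poly :: "'a::field mat \<Rightarrow> 'a poly" where
  "min_poly A = (let n = dim_row A in
     THE p. lead_coeff p = 1 \<and> mat_poly p A = 0\<^sub>m n n \<and>
       (\<forall>q. q \<noteq> 0 \<and> mat_poly q A = 0\<^sub>m n n \<longrightarrow> degree p \<le> degree q))"

definition irreducible_factorization :: "'a::field poly \<Rightarrow> ('a poly \<times> nat) list \<Rightarrow> bool" where
  "irreducible_factorization p fs \<longleftrightarrow>
     distinct (map fst fs) \<and>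
     (\<forall>(f, m) \<in> set fs. lead_coeff f = 1 \<and> irreducible f \<and> 1 \<le> m) \<and>
     p = (\<Prod>(f, m) \<leftarrow> fs. f ^ m)"


section \<open>Unit pseudo annihilating polynomials\<close>

definition row_mult :: "'a::semiring_0 vec \<Rightarrow> 'a mat \<Rightarrow> 'a vec" where
  "row_mult u M = vec (dim_col M) (\<lambda>j. u \<bullet> col M j)"

text \<open>Indices \<open>i\<close>, \<open>j\<close> are counted from 0. The least \<open>k\<close> exists: by the Cayley--Hamilton theorem
  \<open>k = m\<^sub>i\<close> makes the entry vanish.\<close>
definition pap_exponent ::
  "'a::field mat \<Rightarrow> ('a poly \<times> nat) list \<Rightarrow> 'a vec \<Rightarrow> nat \<Rightarrow> nat \<Rightarrow> nat" where
  "pap_exponent A fs u i j = (case fs ! i of (f, m) \<Rightarrow>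
     let g = char_poly A div f ^ m
     in LEAST k. row_mult u (mat_poly g A * mat_poly f A ^\<^sub>m k) $ j = 0)"

definition unit_pap ::
  "'a::field mat \<Rightarrow> ('a poly \<times> nat) list \<Rightarrow> 'a vec \<Rightarrow> nat \<Rightarrow> 'a poly" where
  "unit_pap A fs u j = (\<Prod>i<length fs. fst (fs ! i) ^ pap_exponent A fs u i j)"


section \<open>Counted arithmetic\<close>

text \<open>The state is the number of field operations performed so far. The algorithm computes field
  elements only through the three operations below (no division occurs, since all divisors of
  polynomials are monic). Tests for zero, copying and the handling of indices and exponents are
  not arithmetic operations in the field and are free.\<close>

type_synonym 'r counted = "(nat, 'r) state"

definition add_op :: "'a::field \<Rightarrow> 'a \<Rightarrow> 'a counted" where
  "add_op x y = do { State_Monad.update Suc; State_Monad.return (x + y) }"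

definition sub_op :: "'a::field \<Rightarrow> 'a \<Rightarrow> 'a counted" where
  "sub_op x y = do { State_Monad.update Suc; State_Monad.return (x - y) }"

definition mul_op :: "'a::field \<Rightarrow> 'a \<Rightarrow> 'a counted" where
  "mul_op x y = do { State_Monad.update Suc; State_Monad.return (x * y) }"

fun dot_op :: "'a::field list \<Rightarrow> 'a list \<Rightarrow> 'a counted" where
  "dot_op (x # xs) (y # ys) = do { p \<leftarrow> mul_op x y; s \<leftarrow> dot_op xs ys; add_op p s }"
| "dot_op _ _ = State_Monad.return 0"

definition vec_add_op :: "'a::field vec \<Rightarrow> 'a vec \<Rightarrow> 'a vec counted" where
  "vec_add_op v w = do {
     xs \<leftarrow> State_Monad.traverse_list (\<lambda>(x, y). add_op x y) (zip (list_of_vec v) (list_of_vec w));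
     State_Monad.return (vec_of_list xs) }"

definition vec_scale_op :: "'a::field \<Rightarrow> 'a vec \<Rightarrow> 'a vec counted" where
  "vec_scale_op c v = do {
     xs \<leftarrow> State_Monad.traverse_list (mul_op c) (list_of_vec v);
     State_Monad.return (vec_of_list xs) }"

definition vec_mat_op :: "'a::field vec \<Rightarrow> 'a mat \<Rightarrow> 'a vec counted" where
  "vec_mat_op v A = do {
     xs \<leftarrow> State_Monad.traverse_list
            (\<lambda>j. dot_op (list_of_vec v) (list_of_vec (col A j))) [0..<dim_col A];
     State_Monad.return (vec_of_list xs) }"

text \<open>Horner's rule for the row vector \<open>w f(A)\<close>; the list holds the coefficients of \<open>f\<close>, constant
  coefficient first.\<close>
fun horner_op :: "'a::field vec \<Rightarrow> 'a mat \<Rightarrow> 'a list \<Rightarrow> 'a vec counted" where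
  "horner_op w A [] = State_Monad.return (0\<^sub>v (dim_col A))"
| "horner_op w A [c] = vec_scale_op c w"
| "horner_op w A (c # c' # cs) = do {
     b \<leftarrow> horner_op w A (c' # cs);
     b \<leftarrow> vec_mat_op b A;
     v \<leftarrow> vec_scale_op c w;
     vec_add_op b v }"

text \<open>Schoolbook division by a monic polynomial of degree \<open>d\<close>, on coefficient lists with the constant
  coefficient first. The argument \<open>fl\<close> consists of the \<open>d\<close> non-leading coefficients of the divisor;
  the remainder is kept as a list of length \<open>d\<close>, and the quotient may have leading zeros.\<close>
fun divmod_monic_op :: "'a::field list \<Rightarrow> 'a list \<Rightarrow> ('a list \<times> 'a list) counted" where
  "divmod_monic_op fl [] = State_Monad.return ([], replicate (length fl) 0)"
| "divmod_monic_op fl (c # p) = do {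
     (q, r) \<leftarrow> divmod_monic_op fl p;
     let s = c # r;
     let t = last s;
     r' \<leftarrow> State_Monad.traverse_list (\<lambda>(x, y). do { z \<leftarrow> mul_op t y; sub_op x z })
             (zip (butlast s) fl);
     State_Monad.return (t # q, r') }"

definition div_monic_op :: "'a::field poly \<Rightarrow> 'a poly \<Rightarrow> 'a poly counted" where
  "div_monic_op p f = do {
     (q, r) \<leftarrow> divmod_monic_op (butlast (coeffs f)) (coeffs p);
     State_Monad.return (poly_of_list q) }"

text \<open>The quotient \<open>p / f\<^sup>m\<close>, by \<open>m\<close> successive divisions.\<close>
primrec div_monic_power_op :: "'a::field poly \<Rightarrow> 'a poly \<Rightarrow> nat \<Rightarrow> 'a poly counted" where
  "div_monic_power_op p f 0 = State_Monad.return p"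
| "div_monic_power_op p f (Suc m) = do { q \<leftarrow> div_monic_op p f; div_monic_power_op q f m }"


section \<open>The algorithm\<close>

text \<open>\<^term>\<open>r ! j = None\<close> means that the exponent for the entry \<open>j\<close> has not yet been set.\<close>
definition record_zeros :: "nat \<Rightarrow> 'a::zero vec \<Rightarrow> nat option list \<Rightarrow> nat option list" where
  "record_zeros k b r =
     map (\<lambda>j. if r ! j = None \<and> b $ j = 0 then Some k else r ! j) [0..<length r]"

text \<open>The first argument is the list of values of \<open>k\<close> of the passes that remain.\<close>
primrec passes_op :: "nat list \<Rightarrow> 'a::field mat \<Rightarrow> 'a poly \<Rightarrow> 'a vec \<Rightarrow> nat option list
    \<Rightarrow> nat option list counted" where
  "passes_op [] A f b r = State_Monad.return r"
| "passes_op (k # ks) A f b r =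
     (if b = 0\<^sub>v (dim_row A) \<and> None \<notin> set r then State_Monad.return r
      else do {
        let r' = record_zeros k b r;
        b' \<leftarrow> horner_op b A (coeffs f);
        passes_op ks A f b' r' })"

definition factor_exponents_op ::
  "'a::field mat \<Rightarrow> 'a poly \<Rightarrow> 'a vec \<Rightarrow> 'a poly \<times> nat \<Rightarrow> nat list counted" where
  "factor_exponents_op A chi u = (\<lambda>(f, m). do {
     g \<leftarrow> div_monic_power_op chi f m;
     b \<leftarrow> horner_op u A (coeffs g);
     r \<leftarrow> passes_op [0..<m] A f b (replicate (dim_row A) None);
     State_Monad.return (map (\<lambda>e. case e of None \<Rightarrow> m | Some k \<Rightarrow> k) r) })"

text \<open>\<open>chi\<close> is the characteristic polynomial of \<open>A\<close> and \<open>fs\<close> its factorization; both are given as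
  input, as is the outcome \<open>u\<close> of the random choice of a row vector. Row \<open>i\<close> of the output contains
  the exponents of the \<open>i\<close>-th factor.\<close>
definition algorithm_P ::
  "'a::field mat \<Rightarrow> 'a poly \<Rightarrow> ('a poly \<times> nat) list \<Rightarrow> 'a vec \<Rightarrow> nat list list counted" where
  "algorithm_P A chi fs u = State_Monad.traverse_list (factor_exponents_op A chi u) fs"

end

theory Submission
  imports Defs
begin

text \<open>Let \<open>\<pi>\<close> be the minimal polynomial, \<open>d\<^sub>i = deg f\<^sub>i\<close>, and \<open>e\<^sub>i\<close> the exponent of \<open>f\<^sub>i\<close> in \<open>\<pi>\<close>. By
  Cayley--Hamilton \<open>\<pi>\<close> divides \<open>\<chi>\<close>, so \<open>\<pi>\<close> divides \<open>f\<^sub>i\<^bsup>e\<^sub>i\<^esup> g\<^sub>i\<close>; hence \<open>u g\<^sub>i(A) F\<^sub>i\<^sup>k\<close>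
  vanishes from \<open>k = e\<^sub>i\<close> on, and the \<open>i\<close>-th loop makes at most \<open>e\<^sub>i + 1\<close> passes, of cost \<open>O(n\<^sup>2 d\<^sub>i)\<close>
  each. Since \<open>\<chi>\<close> divides \<open>\<pi>\<^sup>n\<close>, each \<open>e\<^sub>i\<close> is positive, so \<open>e\<^sub>i + 1 \<le> 2 e\<^sub>i\<close>, and \<open>\<Sum> e\<^sub>i d\<^sub>i \<le> deg \<pi>\<close>
  bounds all passes together by \<open>O(n\<^sup>2 deg \<pi>)\<close>. The vectors \<open>u g\<^sub>i(A)\<close> cost
  \<open>O(n\<^sup>2 \<Sum> (n - m\<^sub>i d\<^sub>i)) = O((q - 1) n\<^sup>3)\<close>, and the divisions \<open>\<chi> / f\<^sub>i\<^bsup>m\<^sub>i\<^esup>\<close> only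
  \<open>O(n \<Sum> m\<^sub>i d\<^sub>i) = O(n\<^sup>2)\<close>.\<close>

section \<open>Polynomials in a matrix and the minimal polynomial\<close>

lemma mat_poly_carrier [simp]: "A \<in> carrier_mat n n \<Longrightarrow> mat_poly f A \<in> carrier_mat n n"
  by (simp add: mat_poly_def)

lemma dim_mat_poly [simp]:
  "dim_row (mat_poly f A) = dim_row A" "dim_col (mat_poly f A) = dim_row A"
  by (simp_all add: mat_poly_def)

text \<open>Coefficients beyond the degree vanish, so polynomials of different degrees can be
  evaluated over a common range of summation.\<close>

lemma index_mat_poly:
  assumes "A \<in> carrier_mat n n" "i < n" "j < n" "degree f \<le> N"
  shows "mat_poly f A $$ (i, j) = (\<Sum>k\<le>N. coeff f k * (A ^\<^sub>m k) $$ (i, j))"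
proof -
  have "(\<Sum>k\<le>degree f. coeff f k * (A ^\<^sub>m k) $$ (i, j)) = (\<Sum>k\<le>N. coeff f k * (A ^\<^sub>m k) $$ (i, j))"
    using assms(4) by (intro sum.mono_neutral_left) (auto simp: coeff_eq_0)
  then show ?thesis
    using assms by (simp add: mat_poly_def)
qed

lemma index_mat_mult_sum:
  assumes "P \<in> carrier_mat n n" "Q \<in> carrier_mat n n" "i < n" "j < n"
  shows "(P * Q) $$ (i, j) = (\<Sum>s<n. P $$ (i, s) * Q $$ (s, j))"
  using assms by (simp add: scalar_prod_def atLeast0LessThan)

lemma mat_poly_0 [simp]: "A \<in> carrier_mat n n \<Longrightarrow> mat_poly 0 A = 0\<^sub>m n n"
  by (intro eq_matI) (auto simp: mat_poly_def)

lemma mat_poly_const: "A \<in> carrier_mat n n \<Longrightarrow> mat_poly [:c:] A = c \<cdot>\<^sub>m 1\<^sub>m n"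
  by (intro eq_matI) (auto simp: mat_poly_def)

lemma mat_poly_1: "A \<in> carrier_mat n n \<Longrightarrow> mat_poly 1 A = 1\<^sub>m n"
  using mat_poly_const[of A n 1] by (auto simp: one_pCons intro!: eq_matI)

lemma mat_poly_add:
  assumes "A \<in> carrier_mat n n"
  shows "mat_poly (p + q) A = mat_poly p A + mat_poly q A"
proof (rule eq_matI)
  fix i j assume "i < dim_row (mat_poly p A + mat_poly q A)" "j < dim_col (mat_poly p A + mat_poly q A)"
  with assms have ij: "i < n" "j < n" by simp_all
  let ?N = "max (degree p) (degree q)"
  show "mat_poly (p + q) A $$ (i, j) = (mat_poly p A + mat_poly q A) $$ (i, j)"
    using assms ij index_mat_poly[OF assms ij, of p ?N] index_mat_poly[OF assms ij, of q ?N]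
      index_mat_poly[OF assms ij degree_add_le_max]
    by (simp add: sum.distrib distrib_right)
qed (use assms in simp_all)

lemma mat_poly_smult:
  assumes "A \<in> carrier_mat n n"
  shows "mat_poly (Polynomial.smult c p) A = c \<cdot>\<^sub>m mat_poly p A"
proof (rule eq_matI)
  fix i j assume "i < dim_row (c \<cdot>\<^sub>m mat_poly p A)" "j < dim_col (c \<cdot>\<^sub>m mat_poly p A)"
  with assms have ij: "i < n" "j < n" by simp_all
  show "mat_poly (Polynomial.smult c p) A $$ (i, j) = (c \<cdot>\<^sub>m mat_poly p A) $$ (i, j)"
    using assms ij index_mat_poly[OF assms ij, of p "degree p"]
      index_mat_poly[OF assms ij degree_smult_le]
    by (simp add: sum_distrib_left mult.assoc)
qed (use assms in simp_all)

lemma mat_poly_shift: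
  assumes A: "A \<in> carrier_mat n n"
  shows "mat_poly (pCons 0 p) A = mat_poly p A * A"
proof (rule eq_matI)
  fix i j assume "i < dim_row (mat_poly p A * A)" "j < dim_col (mat_poly p A * A)"
  with A have ij: "i < n" "j < n" by simp_all
  have "mat_poly (pCons 0 p) A $$ (i, j)
      = (\<Sum>k\<le>Suc (degree p). coeff (pCons 0 p) k * (A ^\<^sub>m k) $$ (i, j))"
    using A ij by (intro index_mat_poly degree_pCons_le)
  also have "\<dots> = (\<Sum>k\<le>degree p. coeff p k * (A ^\<^sub>m k * A) $$ (i, j))"
    by (subst sum.atMost_Suc_shift) simp
  also have "\<dots> = (\<Sum>k\<le>degree p. \<Sum>s<n. coeff p k * ((A ^\<^sub>m k) $$ (i, s) * A $$ (s, j)))"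
    using A ij
    by (intro sum.cong refl) (subst index_mat_mult_sum[of _ n], auto simp: sum_distrib_left)
  also have "\<dots> = (\<Sum>s<n. (\<Sum>k\<le>degree p. coeff p k * (A ^\<^sub>m k) $$ (i, s)) * A $$ (s, j))"
    by (subst sum.swap) (simp add: sum_distrib_right mult.assoc)
  also have "\<dots> = (\<Sum>s<n. mat_poly p A $$ (i, s) * A $$ (s, j))"
    using A ij by (intro sum.cong refl) (simp add: mat_poly_def)
  also have "\<dots> = (mat_poly p A * A) $$ (i, j)"
    using A ij by (subst index_mat_mult_sum[of _ n]) auto
  finally show "mat_poly (pCons 0 p) A $$ (i, j) = (mat_poly p A * A) $$ (i, j)" .
qed (use A in simp_all)

lemma mat_poly_pCons:
  assumes "A \<in> carrier_mat n n"
  shows "mat_poly (pCons c p) A = mat_poly p A * A + c \<cdot>\<^sub>m 1\<^sub>m n"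
proof -
  have "pCons c p = pCons 0 p + [:c:]" by simp
  then show ?thesis
    using assms by (simp only: mat_poly_add[OF assms] mat_poly_shift[OF assms] mat_poly_const[OF assms])
qed

text \<open>Induction on the second factor: passing from \<open>q\<close> to
  \<open>pCons c q\<close> multiplies its value by \<open>A\<close> on the right and adds
  \<open>c\<close> times the identity; the rest is ring laws for matrices.\<close>

lemma mat_poly_mult:
  assumes A: "A \<in> carrier_mat n n"
  shows "mat_poly (p * q) A = mat_poly p A * mat_poly q A"
proof (induction q)
  case 0
  show ?case using A by (simp add: right_mult_zero_mat[of _ n n])
next
  case (pCons c q)
  let ?P = "mat_poly p A" and ?Q = "mat_poly q A"
  have P: "?P \<in> carrier_mat n n" and Q: "?Q \<in> carrier_mat n n" using A by simp_all
  have "mat_poly (p * pCons c q) A = c \<cdot>\<^sub>m ?P + (?P * ?Q) * A"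
    using pCons.IH
    by (simp add: mult_pCons_right mat_poly_add[OF A] mat_poly_smult[OF A] mat_poly_shift[OF A])
  also have "\<dots> = (?P * ?Q) * A + c \<cdot>\<^sub>m ?P"
    using A P Q by (intro comm_add_mat[of _ n n]) auto
  also have "c \<cdot>\<^sub>m ?P = ?P * (c \<cdot>\<^sub>m 1\<^sub>m n)"
    using P by (subst mult_smult_distrib[of _ n n]) auto
  also have "(?P * ?Q) * A = ?P * (?Q * A)"
    using A P Q by (intro assoc_mult_mat[of _ n n _ n _ n]) auto
  also have "?P * (?Q * A) + ?P * (c \<cdot>\<^sub>m 1\<^sub>m n) = ?P * (?Q * A + c \<cdot>\<^sub>m 1\<^sub>m n)"
    using A P Q by (intro mult_add_distrib_mat[symmetric, of _ n n _ n]) auto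
  finally show ?case
    by (simp only: mat_poly_pCons[OF A])
qed

lemma mat_poly_power:
  assumes A: "A \<in> carrier_mat n n"
  shows "mat_poly (p ^ k) A = mat_poly p A ^\<^sub>m k"
proof (induction k)
  case 0
  then show ?case using A by (simp add: mat_poly_1[OF A])
next
  case (Suc k)
  have "mat_poly (p ^ Suc k) A = mat_poly (p ^ k * p) A" by (simp add: mult.commute)
  then show ?case using Suc by (simp add: mat_poly_mult[OF A])
qed

lemma mat_poly_sum_index:
  assumes A: "A \<in> carrier_mat n n" and "i < n" "j < n" "finite S"
  shows "mat_poly (\<Sum>s\<in>S. f s) A $$ (i, j) = (\<Sum>s\<in>S. mat_poly (f s) A $$ (i, j))"
  using \<open>finite S\<close>
proof induction
  case empty
  then show ?case using assms by simp
next
  case (insert x S)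
  then show ?case using assms by (simp add: mat_poly_add[OF A])
qed

lemma mat_poly_dvd_eq_0:
  assumes A: "A \<in> carrier_mat n n" and "mat_poly p A = 0\<^sub>m n n" "p dvd q"
  shows "mat_poly q A = 0\<^sub>m n n"
proof -
  obtain r where "q = r * p" using assms(3) by (metis dvdE mult.commute)
  then show ?thesis using assms by (simp add: mat_poly_mult[OF A] right_mult_zero_mat[of _ n n])
qed

section \<open>The Cayley-Hamilton theorem\<close>

lemma index_char_poly_matrix:
  assumes "A \<in> carrier_mat n n" "i < n" "j < n"
  shows "char_poly_matrix A $$ (i, j) = (if i = j then [:- A $$ (i, j), 1:] else [:- A $$ (i, j):])"
  using assms by (auto simp: char_poly_matrix_def)

text \<open>The rows \<open>e\<^sub>j\<close> of the identity satisfy \<open>\<Sum>\<^sub>j (x I - A)\<^sub>i\<^sub>j \<cdot> e\<^sub>j = 0\<close> when polynomials act by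
  \<open>p \<cdot> v = v p(A)\<close>; multiplying by the adjugate of \<open>x I - A\<close> gives \<open>\<chi> \<cdot> e\<^sub>k = 0\<close>.\<close>
lemma cayley_hamilton:
  assumes A: "A \<in> carrier_mat n n"
  shows "mat_poly (char_poly A) A = 0\<^sub>m n n"
proof (rule eq_matI)
  fix k l assume "k < dim_row (0\<^sub>m n n)" "l < dim_col (0\<^sub>m n n)"
  then have k: "k < n" and l: "l < n" by simp_all
  let ?C = "char_poly_matrix A"
  define J where "J = adj_mat ?C"
  have C: "?C \<in> carrier_mat n n" using A by simp
  have J: "J \<in> carrier_mat n n" and JC: "J * ?C = char_poly A \<cdot>\<^sub>m 1\<^sub>m n"
    using adj_mat[OF C] by (simp_all add: J_def char_poly_def)
  \<comment> \<open>Entry \<open>(i, j)\<close> of x I - A, evaluated at \<open>A\<close>, is A -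
    a_ii I on the diagonal and -a_ij I off it; the sum over \<open>j\<close> leaves a_im -
    a_im.\<close>
  have row: "(\<Sum>j<n. mat_poly (?C $$ (i, j)) A $$ (j, m)) = 0" if i: "i < n" and m: "m < n" for i m
  proof -
    have "mat_poly (?C $$ (i, j)) A $$ (j, m)
        = (if j = i then A $$ (j, m) else 0) - (if j = m then A $$ (i, j) else 0)" if j: "j < n" for j
      using A i m j
      by (auto simp: index_char_poly_matrix[OF A i j] mat_poly_pCons[OF A] mat_poly_const[OF A]
          left_mult_zero_mat[of A n n])
    then have "(\<Sum>j<n. mat_poly (?C $$ (i, j)) A $$ (j, m))
        = (\<Sum>j<n. (if j = i then A $$ (j, m) else 0) - (if j = m then A $$ (i, j) else 0))"
      by simp
    also have "\<dots> = 0"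
      using i m by (simp add: sum_subtractf)
    finally show ?thesis .
  qed
  have "mat_poly (char_poly A) A $$ (k, l) = (\<Sum>j<n. mat_poly ((J * ?C) $$ (k, j)) A $$ (j, l))"
  proof -
    have "(\<Sum>j<n. mat_poly ((J * ?C) $$ (k, j)) A $$ (j, l))
        = (\<Sum>j<n. if j = k then mat_poly (char_poly A) A $$ (k, l) else 0)"
      using A k l by (intro sum.cong refl) (auto simp: JC)
    then show ?thesis using k by simp
  qed
  \<comment> \<open>The entry of \<open>?C\<close> is put before that of \<open>J\<close>: after
    evaluation only this first factor contains \<open>j\<close>, so \<open>row\<close> disposes of
    the sum over \<open>j\<close>.\<close>
  also have "\<dots> = (\<Sum>j<n. \<Sum>i<n. mat_poly (?C $$ (i, j) * J $$ (k, i)) A $$ (j, l))"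
    using A k l by (intro sum.cong refl)
      (simp add: index_mat_mult_sum[OF J C] mat_poly_sum_index[of A n] mult.commute)
  also have "\<dots> = (\<Sum>j<n. \<Sum>i<n. \<Sum>m<n. mat_poly (?C $$ (i, j)) A $$ (j, m) * mat_poly (J $$ (k, i)) A $$ (m, l))"
    using A l by (intro sum.cong refl) (simp add: mat_poly_mult[OF A] index_mat_mult_sum[of _ n] del: index_mult_mat)
  also have "\<dots> = (\<Sum>i<n. \<Sum>j<n. \<Sum>m<n. mat_poly (?C $$ (i, j)) A $$ (j, m) * mat_poly (J $$ (k, i)) A $$ (m, l))"
    by (rule sum.swap)
  also have "\<dots> = (\<Sum>i<n. \<Sum>m<n. (\<Sum>j<n. mat_poly (?C $$ (i, j)) A $$ (j, m)) * mat_poly (J $$ (k, i)) A $$ (m, l))"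
    by (rule sum.cong[OF refl], subst sum.swap) (simp add: sum_distrib_right)
  also have "\<dots> = 0"
    by (simp add: row)
  finally show "mat_poly (char_poly A) A $$ (k, l) = 0\<^sub>m n n $$ (k, l)"
    using k l by simp
qed (use A in simp_all)

section \<open>The minimal polynomial\<close>

text \<open>The definite description is legitimate: Cayley-Hamilton supplies an annihilating
  polynomial, one of least degree can be made monic, and two such polynomials coincide.\<close>

lemma min_poly_spec:
  fixes A :: "'a::field mat"
  assumes A: "A \<in> carrier_mat n n"
  shows "lead_coeff (min_poly A) = 1 \<and> mat_poly (min_poly A) A = 0\<^sub>m n n \<and>
    (\<forall>q. q \<noteq> 0 \<and> mat_poly q A = 0\<^sub>m n n \<longrightarrow> degree (min_poly A) \<le> degree q)"
proof -
  let ?ann = "\<lambda>q. q \<noteq> 0 \<and> mat_poly q A = 0\<^sub>m n n"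
  let ?P = "\<lambda>p. lead_coeff p = 1 \<and> mat_poly p A = 0\<^sub>m n n \<and> (\<forall>q. ?ann q \<longrightarrow> degree p \<le> degree q)"
  have "?ann (char_poly A)"
    using cayley_hamilton[OF A] degree_monic_char_poly[OF A] by auto
  then obtain p where p: "?ann p" and least: "\<And>q. ?ann q \<Longrightarrow> degree p \<le> degree q"
    using ex_has_least_nat[of ?ann _ degree] by blast
  let ?p = "Polynomial.smult (inverse (lead_coeff p)) p"
  have "?P ?p"
    using p least A by (auto simp: mat_poly_smult[OF A])
  moreover have "p1 = p2" if 1: "?P p1" and 2: "?P p2" for p1 p2
  proof (rule ccontr)
    assume ne: "p1 \<noteq> p2"
    have "?ann p1" "?ann p2" using 1 2 by auto
    then have deg: "degree p1 = degree p2" using 1 2 by (simp add: le_antisym)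
    have "p1 - p2 = p1 + Polynomial.smult (- 1) p2" by simp
    then have "mat_poly (p1 - p2) A = 0\<^sub>m n n"
      using 1 2 A by (simp only: mat_poly_add[OF A] mat_poly_smult[OF A]) (auto intro!: eq_matI)
    then have le: "degree p1 \<le> degree (p1 - p2)" using 1 ne by auto
    \<comment> \<open>The degree of a nonzero difference is squeezed to \<open>degree p1\<close>,
      but there the two leading coefficients cancel.\<close>
    have "coeff (p1 - p2) (degree p1) = 0" using 1 2 deg by simp
    moreover have "degree (p1 - p2) \<le> degree p1" using deg by (simp add: degree_diff_le)
    ultimately have "lead_coeff (p1 - p2) = 0" using le by (metis le_antisym)
    then have "p1 - p2 = 0" by (rule leading_coeff_0_iff[THEN iffD1])
    then show False using ne by simp
  qed
  ultimately have "\<exists>!p. ?P p" by blast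
  then have "?P (THE p. ?P p)" by (rule theI')
  then show ?thesis using A by (simp add: min_poly_def)
qed

text \<open>The remainder of \<open>q\<close> modulo the minimal polynomial annihilates
  \<open>A\<close> too; were it nonzero, it would violate minimality of the degree.\<close>

lemma min_poly_dvd:
  assumes A: "A \<in> carrier_mat n n" and q: "mat_poly q A = 0\<^sub>m n n"
  shows "min_poly A dvd q"
proof (rule ccontr)
  let ?p = "min_poly A"
  assume "\<not> ?p dvd q"
  then have r: "q mod ?p \<noteq> 0" by (simp add: dvd_eq_mod_eq_0)
  have p: "?p \<noteq> 0" "mat_poly ?p A = 0\<^sub>m n n" using min_poly_spec[OF A] by auto
  have "q mod ?p = q + ?p * (- (q div ?p))"
    by (simp add: minus_mult_div_eq_mod[symmetric])
  then have "mat_poly (q mod ?p) A = 0\<^sub>m n n"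
    using A p q by (simp only: mat_poly_add[OF A] mat_poly_mult[OF A])
      (simp add: left_mult_zero_mat[of _ n n])
  then have "degree ?p \<le> degree (q mod ?p)" using min_poly_spec[OF A] r by blast
  then show False using degree_mod_less'[OF p(1) r] by simp
qed

text \<open>\<open>p(x) I - p(A) = (x I - A) B(x)\<close> for some \<open>B\<close>; taking determinants for an annihilating \<open>p\<close>
  gives \<open>p\<^sup>n = \<chi> det B\<close>.\<close>
lemma char_poly_dvd_power:
  assumes A: "A \<in> carrier_mat n n" and p: "mat_poly p A = 0\<^sub>m n n"
  shows "char_poly A dvd p ^ n"
proof -
  let ?C = "char_poly_matrix A" and ?K = "map_mat (\<lambda>a :: 'a. [:a:])"
  have C: "?C \<in> carrier_mat n n" using A by simp
  \<comment> \<open>Writing x r(A) as (x I - A) r(A) + A r(A) turns the cofactor B for r into the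
    cofactor x B + r(A) for x r + c.\<close>
  have ex: "\<exists>B \<in> carrier_mat n n. r \<cdot>\<^sub>m 1\<^sub>m n = ?C * B + ?K (mat_poly r A)" for r
  proof (induction r)
    case 0
    show ?case using A by (intro bexI[of _ "0\<^sub>m n n"]) (auto simp: right_mult_zero_mat[OF C])
  next
    case (pCons c r)
    then obtain B where B: "B \<in> carrier_mat n n" and eq: "r \<cdot>\<^sub>m 1\<^sub>m n = ?C * B + ?K (mat_poly r A)"
      by blast
    let ?R = "?K (mat_poly r A)"
    have R: "?R \<in> carrier_mat n n" using A by simp
    let ?x = "[:0, 1:] :: 'a poly" and ?I = "1\<^sub>m n :: 'a poly mat"
    have KA: "?K A \<in> carrier_mat n n" using A by simp
    have x: "?x \<cdot>\<^sub>m ?I = ?C + ?K A"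
      using A by (intro eq_matI) (auto simp: index_char_poly_matrix[OF A] one_pCons)
    interpret const: semiring_hom "\<lambda>a :: 'a. [:a:]"
      by unfold_locales (simp_all add: one_pCons)
    \<comment> \<open>The splitting of x I yields A r(A), the recursion for \<open>pCons\<close>
      yields r(A) A; both are the value of x r at \<open>A\<close>.\<close>
    have hom: "?K A * ?R = ?K (mat_poly r A * A)"
    proof -
      have "mat_poly r A * A = A * mat_poly r A"
      proof -
        have "mat_poly ?x A = A"
          using mat_poly_shift[OF A, of 1] A by (simp add: mat_poly_1[OF A])
        then show ?thesis
          using mat_poly_mult[OF A, of r ?x] mat_poly_mult[OF A, of ?x r] mult.commute[of r ?x] by simp
      qed
      then show ?thesis
        using const.mat_hom_mult[OF A, of "mat_poly r A" n] A by simp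
    qed
    have "pCons c r \<cdot>\<^sub>m ?I = ?x \<cdot>\<^sub>m (r \<cdot>\<^sub>m ?I) + [:c:] \<cdot>\<^sub>m ?I"
      by (intro eq_matI) (auto simp: pCons_one)
    also have "?x \<cdot>\<^sub>m (r \<cdot>\<^sub>m ?I) = ?C * (?x \<cdot>\<^sub>m B) + ?x \<cdot>\<^sub>m ?R"
      unfolding eq using B C R
      by (simp add: add_smult_distrib_left_mat[of _ n n] mult_smult_distrib[of _ n n])
    also have "?x \<cdot>\<^sub>m ?R = (?x \<cdot>\<^sub>m ?I) * ?R"
      using R by (subst mult_smult_assoc_mat[of _ n n]) auto
    also have "\<dots> = ?C * ?R + ?K (mat_poly r A * A)"
      unfolding x hom[symmetric] using C KA R by (intro add_mult_distrib_mat[of _ n n]) auto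
    also have "?C * (?x \<cdot>\<^sub>m B) + (?C * ?R + ?K (mat_poly r A * A)) + [:c:] \<cdot>\<^sub>m ?I
        = (?C * (?x \<cdot>\<^sub>m B) + ?C * ?R) + (?K (mat_poly r A * A) + [:c:] \<cdot>\<^sub>m ?I)"
    proof -
      have "?C * (?x \<cdot>\<^sub>m B) \<in> carrier_mat n n" "?C * ?R \<in> carrier_mat n n"
        "?K (mat_poly r A * A) \<in> carrier_mat n n" "[:c:] \<cdot>\<^sub>m ?I \<in> carrier_mat n n"
        using A B C R by (auto intro: mult_carrier_mat[OF C])
      then show ?thesis by (simp add: assoc_add_mat[of _ n n])
    qed
    also have "?C * (?x \<cdot>\<^sub>m B) + ?C * ?R = ?C * (?x \<cdot>\<^sub>m B + ?R)"
      using B C R by (intro mult_add_distrib_mat[symmetric, of _ n n _ n]) auto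
    also have "?K (mat_poly r A * A) + [:c:] \<cdot>\<^sub>m ?I = ?K (mat_poly (pCons c r) A)"
      using A by (intro eq_matI) (auto simp: mat_poly_pCons[OF A])
    finally show ?case
      using B R by (intro bexI[of _ "?x \<cdot>\<^sub>m B + ?R"]) auto
  qed
  then obtain B where B: "B \<in> carrier_mat n n" and "p \<cdot>\<^sub>m 1\<^sub>m n = ?C * B + ?K (mat_poly p A)"
    by blast
  moreover have "?K (0\<^sub>m n n) = 0\<^sub>m n n" by (auto intro!: eq_matI)
  ultimately have "p \<cdot>\<^sub>m 1\<^sub>m n = ?C * B"
    using p mult_carrier_mat[OF C B] by simp
  then have "det (p \<cdot>\<^sub>m 1\<^sub>m n) = det ?C * det B" by (simp add: det_mult[OF C B])
  then show ?thesis by (simp add: char_poly_def)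
qed

section \<open>Costs of counted computations\<close>

text \<open>Result and cost are stated together and for every initial counter, so that the relation
  composes along a bind. A bound replaces the exact count, which depends on when the loop is
  left.\<close>

definition runs_within :: "'r counted \<Rightarrow> 'r \<Rightarrow> nat \<Rightarrow> bool" where
  "runs_within m r c \<longleftrightarrow> (\<forall>s. \<exists>c'\<le>c. run_state m s = (r, s + c'))"

lemma runs_within_return: "runs_within (State_Monad.return x) x c"
  by (auto simp: runs_within_def)

lemma runs_within_bind:
  assumes "runs_within m r c" "runs_within (k r) r' c'"
  shows "runs_within (State_Monad.bind m k) r' (c + c')"
  unfolding runs_within_def
proof
  fix s
  obtain a where a: "a \<le> c" "run_state m s = (r, s + a)"
    using assms(1) by (auto simp: runs_within_def)
  obtain b where b: "b \<le> c'" "run_state (k r) (s + a) = (r', s + a + b)"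
    using assms(2) by (auto simp: runs_within_def)
  show "\<exists>d\<le>c + c'. run_state (State_Monad.bind m k) s = (r', s + d)"
    using a b by (intro exI[of _ "a + b"]) (auto simp: add.assoc)
qed

lemma runs_within_mono: "runs_within m r c \<Longrightarrow> c \<le> c' \<Longrightarrow> runs_within m r c'"
  unfolding runs_within_def by (meson order_trans)

lemma runs_within_bind_return:
  assumes "runs_within m r c"
  shows "runs_within (State_Monad.bind m (\<lambda>x. State_Monad.return (k x))) (k r) c"
  using runs_within_bind[OF assms runs_within_return[of _ 0]] by simp

lemma runs_within_traverse_list:
  assumes "\<And>x. x \<in> set xs \<Longrightarrow> runs_within (f x) (g x) (c x)"
  shows "runs_within (State_Monad.traverse_list f xs) (map g xs) (\<Sum>x\<leftarrow>xs. c x)"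
  using assms
proof (induction xs)
  case Nil
  then show ?case by (simp add: runs_within_return)
next
  case (Cons x xs)
  then show ?case
    by (auto intro!: runs_within_bind runs_within_bind_return)
qed

lemma runs_within_traverse_list_const:
  assumes "\<And>x. x \<in> set xs \<Longrightarrow> runs_within (f x) (g x) c"
  shows "runs_within (State_Monad.traverse_list f xs) (map g xs) (length xs * c)"
  using runs_within_traverse_list[of xs f g "\<lambda>_. c"] assms by (simp add: sum_list_triv)

lemma runs_within_add_op: "runs_within (add_op x y) (x + y) 1"
  and runs_within_sub_op: "runs_within (sub_op x y) (x - y) 1"
  and runs_within_mul_op: "runs_within (mul_op x y) (x * y) 1"
  by (simp_all add: runs_within_def add_op_def sub_op_def mul_op_def State_Monad.update_def)

text \<open>Every coordinate costs one multiplication and one addition, the last of which adds the 0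
  of the empty sum.\<close>

lemma runs_within_dot_op:
  assumes "length xs = length ys"
  shows "runs_within (dot_op xs ys) (\<Sum>i<length xs. xs ! i * ys ! i) (2 * length xs)"
  using assms
proof (induction xs ys rule: list_induct2)
  case Nil
  then show ?case by (simp add: runs_within_return)
next
  case (Cons x xs y ys)
  have "runs_within (dot_op (x # xs) (y # ys)) (x * y + (\<Sum>i<length xs. xs ! i * ys ! i))
      (1 + (2 * length xs + 1))"
    unfolding dot_op.simps
    by (rule runs_within_mul_op runs_within_add_op Cons.IH runs_within_bind)+
  then show ?case by (simp add: sum.lessThan_Suc_shift del: sum.lessThan_Suc)
qed

lemma runs_within_vec_add_op:
  assumes "v \<in> carrier_vec n" "w \<in> carrier_vec n"
  shows "runs_within (vec_add_op v w) (v + w) n"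
proof -
  let ?z = "zip (list_of_vec v) (list_of_vec w)"
  have "runs_within (State_Monad.traverse_list (\<lambda>(x, y). add_op x y) ?z)
      (map (\<lambda>(x, y). x + y) ?z) (length ?z * 1)"
    by (intro runs_within_traverse_list_const) (auto intro: runs_within_add_op[unfolded One_nat_def])
  from runs_within_bind_return[OF this, of vec_of_list]
  have "runs_within (vec_add_op v w) (vec_of_list (map (\<lambda>(x, y). x + y) ?z)) n"
    using assms by (simp add: vec_add_op_def)
  moreover have "vec_of_list (map (\<lambda>(x, y). x + y) ?z) = v + w"
    using assms by (intro eq_vecI) (auto simp: vec_of_list_index list_of_vec_index)
  ultimately show ?thesis by simp
qed

lemma runs_within_vec_scale_op:
  assumes "v \<in> carrier_vec n"
  shows "runs_within (vec_scale_op c v) (c \<cdot>\<^sub>v v) n"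
proof -
  have "runs_within (State_Monad.traverse_list (mul_op c) (list_of_vec v))
      (map ((*) c) (list_of_vec v)) (length (list_of_vec v) * 1)"
    by (intro runs_within_traverse_list_const runs_within_mul_op)
  from runs_within_bind_return[OF this, of vec_of_list]
  have "runs_within (vec_scale_op c v) (vec_of_list (map ((*) c) (list_of_vec v))) n"
    using assms by (simp add: vec_scale_op_def)
  moreover have "vec_of_list (map ((*) c) (list_of_vec v)) = c \<cdot>\<^sub>v v"
    using assms by (intro eq_vecI) (auto simp: vec_of_list_index list_of_vec_index)
  ultimately show ?thesis by simp
qed

lemma runs_within_vec_mat_op:
  assumes "v \<in> carrier_vec n" "A \<in> carrier_mat n n"
  shows "runs_within (vec_mat_op v A) (row_mult v A) (2 * n^2)"
proof -
  let ?d = "\<lambda>j. \<Sum>i<n. v $ i * col A j $ i"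
  have "runs_within (State_Monad.traverse_list
        (\<lambda>j. dot_op (list_of_vec v) (list_of_vec (col A j))) [0..<dim_col A])
      (map ?d [0..<dim_col A]) (length [0..<dim_col A] * (2 * n))"
  proof (intro runs_within_traverse_list_const)
    fix j assume "j \<in> set [0..<dim_col A]"
    then show "runs_within (dot_op (list_of_vec v) (list_of_vec (col A j))) (?d j) (2 * n)"
      using runs_within_dot_op[of "list_of_vec v" "list_of_vec (col A j)"] assms
      by (simp add: list_of_vec_index)
  qed
  from runs_within_bind_return[OF this, of vec_of_list]
  have "runs_within (vec_mat_op v A) (vec_of_list (map ?d [0..<dim_col A])) (2 * n^2)"
    using assms by (simp add: vec_mat_op_def power2_eq_square mult.left_commute)
  moreover have "vec_of_list (map ?d [0..<dim_col A]) = row_mult v A"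
    using assms by (intro eq_vecI)
      (auto simp: vec_of_list_index row_mult_def scalar_prod_def atLeast0LessThan)
  ultimately show ?thesis by simp
qed

section \<open>Row vectors times matrices and Horner's rule\<close>

lemma row_mult_carrier [simp]: "M \<in> carrier_mat n m \<Longrightarrow> row_mult v M \<in> carrier_vec m"
  by (simp add: row_mult_def)

text \<open>Transposition reduces row vectors to the matrix-vector product, from which associativity
  is inherited.\<close>

lemma row_mult_eq_transpose:
  fixes v :: "'a::comm_ring_1 vec"
  assumes "v \<in> carrier_vec n" "M \<in> carrier_mat n m"
  shows "row_mult v M = transpose_mat M *\<^sub>v v"
  using assms by (intro eq_vecI) (auto simp: row_mult_def intro: comm_scalar_prod)

lemma row_mult_mult:
  fixes v :: "'a::comm_ring_1 vec"
  assumes "v \<in> carrier_vec n" "M \<in> carrier_mat n n" "N \<in> carrier_mat n n"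
  shows "row_mult v (M * N) = row_mult (row_mult v M) N"
  using assms row_mult_eq_transpose[of v n "M * N" n] row_mult_eq_transpose[of v n M n]
    row_mult_eq_transpose[of "row_mult v M" n N n]
  by (simp add: transpose_mult[of M n n N n] assoc_mult_mat_vec[of _ n n _ n])

text \<open>With \<open>M\<close> of the form P A this is the algebra of one Horner step.\<close>

lemma row_mult_add_smult_one:
  fixes v :: "'a::comm_ring_1 vec"
  assumes v: "v \<in> carrier_vec n" and M: "M \<in> carrier_mat n n"
  shows "row_mult v (M + c \<cdot>\<^sub>m 1\<^sub>m n) = row_mult v M + c \<cdot>\<^sub>v v"
proof (rule eq_vecI)
  fix j assume "j < dim_vec (row_mult v M + c \<cdot>\<^sub>v v)"
  then have j: "j < n" using v by simp
  have "row_mult v (M + c \<cdot>\<^sub>m 1\<^sub>m n) $ j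
      = (\<Sum>i = 0..<n. v $ i * M $$ (i, j) + (if i = j then c * v $ j else 0))"
    using v M j by (auto simp: row_mult_def scalar_prod_def algebra_simps intro!: sum.cong)
  then show "row_mult v (M + c \<cdot>\<^sub>m 1\<^sub>m n) $ j = (row_mult v M + c \<cdot>\<^sub>v v) $ j"
    using v M j by (simp add: sum.distrib row_mult_def scalar_prod_def)
qed (use v M in \<open>simp_all add: row_mult_def\<close>)

lemma row_mult_zero [simp]: "v \<in> carrier_vec n \<Longrightarrow> row_mult v (0\<^sub>m n m) = 0\<^sub>v m"
  by (intro eq_vecI) (auto simp: row_mult_def)

text \<open>Each degree costs a vector-matrix product, a scaling and a vector addition; the final
  \<open>n\<close> is the scaling by the leading coefficient.\<close>

definition horner_cost :: "nat \<Rightarrow> nat \<Rightarrow> nat" where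
  "horner_cost n d = d * (2 * n^2 + 2 * n) + n"

lemma runs_within_horner_op:
  assumes w: "w \<in> carrier_vec n" and A: "A \<in> carrier_mat n n"
  shows "runs_within (horner_op w A (coeffs f)) (row_mult w (mat_poly f A)) (horner_cost n (degree f))"
proof -
  \<comment> \<open>Arbitrary coefficient lists let the induction follow the recursion of
    \<open>horner_op\<close>; for the empty list the truncated \<open>length cs - 1\<close> is
    0.\<close>
  have "runs_within (horner_op w A cs) (row_mult w (mat_poly (Poly cs) A)) (horner_cost n (length cs - 1))" for cs
  proof (induction cs rule: induct_list012)
    case 1
    show ?case using A w
      by (auto intro: runs_within_return)
  next
    case (2 c)
    have "row_mult w (mat_poly [:c:] A) = c \<cdot>\<^sub>v w"
      using row_mult_add_smult_one[OF w, of "0\<^sub>m n n" c] w A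
      by (simp add: mat_poly_const[OF A] left_add_zero_mat[of _ n n])
    then show ?case using runs_within_vec_scale_op[OF w, of c]
      by (simp add: horner_cost_def)
  next
    case (3 c c' cs)
    let ?P = "mat_poly (Poly (c' # cs)) A"
    have P: "?P \<in> carrier_mat n n" using A by simp
    have "row_mult w (mat_poly (Poly (c # c' # cs)) A) = row_mult (row_mult w ?P) A + c \<cdot>\<^sub>v w"
    proof -
      have "mat_poly (Poly (c # c' # cs)) A = ?P * A + c \<cdot>\<^sub>m 1\<^sub>m n"
        by (simp add: mat_poly_pCons[OF A])
      then show ?thesis
        using w P A by (simp only: row_mult_add_smult_one[of w n "?P * A"] row_mult_mult[of w n ?P A] mult_carrier_mat)
    qed
    moreover have "runs_within (horner_op w A (c # c' # cs)) (row_mult (row_mult w ?P) A + c \<cdot>\<^sub>v w)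
      (horner_cost n (length (c' # cs) - 1) + (2 * n^2 + (n + n)))"
      unfolding horner_op.simps
      by (rule "3.IH"(2) runs_within_vec_mat_op[OF row_mult_carrier[OF P] A] runs_within_vec_scale_op[OF w]
          runs_within_vec_add_op runs_within_bind)+ (use w A in auto)
    ultimately show ?case by (simp add: horner_cost_def algebra_simps)
  qed
  from this[of "coeffs f"] show ?thesis
    by (simp add: degree_eq_length_coeffs)
qed

section \<open>Division by a monic polynomial\<close>

lemma Poly_map2_diff:
  assumes "length xs = length ys"
  shows "Poly (map (\<lambda>(x, y). x - t * y) (zip xs ys)) = Poly xs - Polynomial.smult t (Poly ys)"
  using assms by (induction xs ys rule: list_induct2) simp_all

text \<open>Let p = Q f + R with f monic of degree d, and let t be the coefficient of x^d in c + x
  R. Then c + x p = (t + x Q) f + (c + x R - t f), where the terms t x^d in the last bracket cancel.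
  Each coefficient of the dividend costs d multiplications and d subtractions.\<close>

lemma runs_within_divmod_monic_op:
  fixes p fl :: "'a::field list"
  shows "\<exists>q r. runs_within (divmod_monic_op fl p) (q, r) (2 * length fl * length p) \<and>
    length r = length fl \<and> Poly p = Poly q * Poly (fl @ [1]) + Poly r"
proof (induction p)
  case Nil
  show ?case
    by (intro exI[of _ "[]"] exI[of _ "replicate (length fl) 0"])
       (use Poly_append_replicate_zero[of "[]"] in \<open>simp add: runs_within_return\<close>)
next
  case (Cons c p)
  then obtain q r where run: "runs_within (divmod_monic_op fl p) (q, r) (2 * length fl * length p)"
    and len: "length r = length fl" and eq: "Poly p = Poly q * Poly (fl @ [1]) + Poly r" by blast
  let ?s = "c # r"
  let ?t = "last ?s"
  let ?z = "zip (butlast ?s) fl"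
  let ?r = "map (\<lambda>(x, y). x - ?t * y) ?z"
  have "runs_within (State_Monad.traverse_list (\<lambda>(x, y). do { z \<leftarrow> mul_op ?t y; sub_op x z }) ?z)
      ?r (length ?z * (1 + 1))"
    by (intro runs_within_traverse_list_const)
       (auto intro!: runs_within_bind[OF runs_within_mul_op runs_within_sub_op, simplified])
  from runs_within_bind_return[OF this, of "\<lambda>r'. (?t # q, r')"]
  have "runs_within (divmod_monic_op fl (c # p)) (?t # q, ?r) (2 * length fl * length p + 2 * length fl)"
    unfolding divmod_monic_op.simps
    by (intro runs_within_bind[OF run]) (simp add: Let_def len mult_2 del: last.simps butlast.simps)
  moreover have "Poly (c # p) = Poly (?t # q) * Poly (fl @ [1]) + Poly ?r"
  proof -
    have l: "length (butlast ?s) = length fl" using len by (simp del: butlast.simps)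
    have "Poly ?s = Poly (butlast ?s @ [?t])" by (subst append_butlast_last_id) auto
    also have "\<dots> = Poly (butlast ?s) + Polynomial.smult ?t (monom 1 (length fl))"
      by (simp add: Poly_snoc l len smult_monom del: last.simps butlast.simps append_butlast_last_id)
    finally have s: "pCons c (Poly r) = Poly (butlast ?s) + Polynomial.smult ?t (monom 1 (length fl))"
      unfolding Poly.simps .
    have "pCons c (Poly p) = pCons c (Poly r) + pCons 0 (Poly q * Poly (fl @ [1]))"
      by (simp add: eq)
    then show ?thesis
      by (simp add: s Poly_map2_diff[OF l] Poly_snoc smult_add_right del: last.simps butlast.simps)
  qed
  ultimately show ?case using len by (intro exI[of _ "?t # q"] exI[of _ ?r]) (auto simp: algebra_simps)
qed

text \<open>The remainder is a multiple of \<open>f\<close> with fewer than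
  \<open>degree f + 1\<close> coefficients, hence 0, so the computed quotient is
  \<open>g\<close>.\<close>

lemma runs_within_div_monic_op:
  fixes f :: "'a::field poly"
  assumes f: "lead_coeff f = 1"
  shows "runs_within (div_monic_op (f * g) f) g (2 * degree f * (degree (f * g) + 1))"
proof -
  let ?fl = "butlast (coeffs f)"
  have f0: "f \<noteq> 0" using f by auto
  have "coeffs f = ?fl @ [1]"
    using f f0 by (metis append_butlast_last_id coeffs_eq_Nil last_coeffs_eq_coeff_degree)
  then have pf: "Poly (?fl @ [1]) = f" by (metis Poly_coeffs)
  have len: "length ?fl = degree f" by (simp add: degree_eq_length_coeffs)
  obtain q r where run: "runs_within (divmod_monic_op ?fl (coeffs (f * g))) (q, r)
      (2 * degree f * length (coeffs (f * g)))"
    and r: "length r = degree f" and eq: "f * g = Poly q * f + Poly r"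
    using runs_within_divmod_monic_op[of ?fl "coeffs (f * g)"] pf len by (metis Poly_coeffs)
  have "Poly r = f * (g - Poly q)" using eq by (simp add: algebra_simps)
  moreover have "\<not> f dvd Poly r" if "Poly r \<noteq> 0"
  proof
    assume "f dvd Poly r"
    then have "degree f \<le> degree (Poly r)" using that by (rule dvd_imp_degree_le)
    moreover have "degree (Poly r) < length r"
    proof (rule degree_lessI)
      show "Poly r \<noteq> 0 \<or> 0 < length r" using that by simp
    qed (simp add: nth_default_beyond)
    ultimately show False using r by simp
  qed
  ultimately have "Poly q = g" using f0 by auto
  moreover have "2 * degree f * length (coeffs (f * g)) \<le> 2 * degree f * (degree (f * g) + 1)"
    by (intro mult_le_mono2) (simp add: degree_eq_length_coeffs)
  ultimately show ?thesis
    using runs_within_mono[OF runs_within_bind_return[OF run, of "\<lambda>(q, r). poly_of_list q"]]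
    by (fastforce simp add: div_monic_op_def case_prod_unfold)
qed

text \<open>Degrees do not grow along the \<open>m\<close> divisions, so each is charged the price
  of the first.\<close>

lemma runs_within_div_monic_power_op:
  fixes f :: "'a::field poly"
  assumes f: "lead_coeff f = 1"
  shows "runs_within (div_monic_power_op (f ^ m * g) f m) g (m * (2 * degree f * (degree (f ^ m * g) + 1)))"
proof (induction m)
  case 0
  show ?case by (simp add: runs_within_return)
next
  case (Suc m)
  have f0: "f \<noteq> 0" using f by auto
  let ?h = "f ^ m * g"
  have "degree ?h \<le> degree (f * ?h)"
    using f0 by (cases "?h = 0") (simp_all add: degree_mult_eq)
  then have "runs_within (div_monic_power_op ?h f m) g (m * (2 * degree f * (degree (f * ?h) + 1)))"
    by (intro runs_within_mono[OF Suc.IH]) auto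
  from runs_within_bind[OF runs_within_div_monic_op[OF f, of ?h], of "\<lambda>q. div_monic_power_op q f m", OF this]
  show ?case by (simp add: mult.assoc)
qed

section \<open>Factors of the minimal polynomial\<close>

text \<open>If f^m g = h k, the prime \<open>f\<close> does not divide \<open>h\<close>, so f^m
  divides k and can be cancelled.\<close>

lemma prime_elem_coprime_part_dvd:
  fixes f :: "'a::{idom, algebraic_semidom}"
  assumes f: "prime_elem f" and h: "\<not> f dvd h" "h dvd f ^ m * g"
  shows "h dvd g"
proof (cases "m = 0")
  case False
  obtain k where k: "f ^ m * g = h * k" using h(2) by blast
  then have "f ^ m dvd h * k" by (metis dvd_triv_left)
  then have "f ^ m dvd k" using prime_power_dvd_multD[OF f] h(1) False by blast
  then obtain k' where "k = f ^ m * k'" by blast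
  then have "f ^ m * g = f ^ m * (h * k')" using k by (simp add: ac_simps)
  then have "g = h * k'" using prime_elem_not_zeroI[OF f] by simp
  then show ?thesis by simp
qed (use h in simp)

lemma monic_irreducible_dvd_eq:
  fixes f g :: "'a::field poly"
  assumes "irreducible f" "irreducible g" "lead_coeff f = 1" "lead_coeff g = 1" "f dvd g"
  shows "f = g"
proof -
  obtain k where k: "g = f * k" using assms(5) by blast
  have "is_unit k" using irreducibleD[OF assms(2) k] assms(1) irreducible_not_unit by blast
  then obtain c where "k = [:c:]" by (metis is_unit_polyE)
  then show ?thesis using k assms(3,4) by (cases "c = 0") auto
qed

text \<open>After a power of \<open>f\<close> is split off, the power of any other factor g still
  divides the cofactor, because the prime g does not divide a power of \<open>f\<close>.\<close>

lemma prod_monic_irreducible_powers_dvd: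
  fixes p :: "'a::field poly"
  assumes "distinct fs" "\<And>f. f \<in> set fs \<Longrightarrow> irreducible f \<and> lead_coeff f = 1 \<and> f ^ e f dvd p"
  shows "(\<Prod>f\<leftarrow>fs. f ^ e f) dvd p"
  using assms
proof (induction fs arbitrary: p)
  case Nil
  then show ?case by simp
next
  case (Cons f fs)
  have "f ^ e f dvd p" using Cons.prems(2)[of f] by simp
  then obtain r where r: "p = f ^ e f * r" by (elim dvdE)
  have "g ^ e g dvd r" if g: "g \<in> set fs" for g
  proof (cases "e g = 0")
    case False
    have gi: "irreducible g" "lead_coeff g = 1" "irreducible f" "lead_coeff f = 1" "g ^ e g dvd f ^ e f * r"
      using Cons.prems(2)[of g] Cons.prems(2)[of f] g r by auto
    have pe: "prime_elem g" using gi(1) by (rule field_poly_irreducible_imp_prime)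
    have "\<not> g dvd f ^ e f"
    proof
      assume "g dvd f ^ e f"
      then have "g dvd f" using pe prime_elem_dvd_power by blast
      then have "g = f" using monic_irreducible_dvd_eq gi by blast
      then show False using Cons.prems(1) g by simp
    qed
    then show ?thesis using prime_power_dvd_multD[OF pe gi(5)] False by simp
  qed simp
  then have "(\<Prod>f\<leftarrow>fs. f ^ e f) dvd r"
    using Cons.prems by (intro Cons.IH) auto
  then show ?case by (simp add: r)
qed

lemma degree_prod_list_powers:
  fixes fs :: "'a::field poly list"
  assumes "\<And>f. f \<in> set fs \<Longrightarrow> f \<noteq> 0"
  shows "degree (\<Prod>f\<leftarrow>fs. f ^ e f) = (\<Sum>f\<leftarrow>fs. e f * degree f)"
  using assms
proof (induction fs)
  case (Cons f fs)
  have "(\<Prod>f\<leftarrow>fs. f ^ e f) \<noteq> 0"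
    using Cons.prems by (auto simp: prod_list_zero_iff)
  then show ?case using Cons by (simp add: degree_mult_eq degree_power_eq)
qed simp

section \<open>The passes for one factor\<close>

text \<open>This is the loop invariant: the record for entry \<open>j\<close> before pass
  \<open>k\<close>. The least index may range over all naturals, since some index below
  \<open>k\<close> qualifies.\<close>

definition first_zero_below :: "(nat \<Rightarrow> 'a::zero vec) \<Rightarrow> nat \<Rightarrow> nat \<Rightarrow> nat option" where
  "first_zero_below v k j = (if \<exists>i<k. v i $ j = 0 then Some (LEAST i. v i $ j = 0) else None)"

lemma record_zeros_first_zero_below:
  "record_zeros k (v k) (map (first_zero_below v k) [0..<n]) = map (first_zero_below v (Suc k)) [0..<n]"
proof -
  have "(LEAST i. v i $ j = 0) = k" if "\<not> (\<exists>i<k. v i $ j = 0)" "v k $ j = 0" for j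
    using that by (intro Least_equality) (auto simp: not_less[symmetric])
  then show ?thesis
    by (auto simp: record_zeros_def first_zero_below_def less_Suc_eq)
qed

text \<open>\<open>v k\<close> is the vector at the start of pass \<open>k\<close>, and
  \<open>Suc e - k\<close> counts the passes \<open>k\<close> to \<open>e\<close> that may still be
  carried out.\<close>

lemma runs_within_passes_op:
  assumes A: "A \<in> carrier_mat n n"
    and v: "\<And>k. v k \<in> carrier_vec n"
    and step: "\<And>k. v (Suc k) = row_mult (v k) (mat_poly f A)"
    and zero: "\<And>k. e \<le> k \<Longrightarrow> v k = 0\<^sub>v n"
    and "k \<le> m"
  shows "runs_within (passes_op [k..<m] A f (v k) (map (first_zero_below v k) [0..<n]))
    (map (first_zero_below v m) [0..<n]) ((Suc e - k) * horner_cost n (degree f))"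
  using \<open>k \<le> m\<close>
proof (induction "m - k" arbitrary: k)
  case 0
  then show ?case by (auto intro: runs_within_return)
next
  case (Suc d)
  let ?r = "\<lambda>k. map (first_zero_below v k) [0..<n]"
  have upt: "[k..<m] = k # [Suc k..<m]" using Suc.hyps(2) by (simp add: upt_conv_Cons)
  show ?case
  proof (cases "v k = 0\<^sub>v n \<and> None \<notin> set (?r k)")
    case True
    \<comment> \<open>Leaving the loop early is harmless: every entry already has its first zero,
      which later passes do not change.\<close>
    have "first_zero_below v m j = first_zero_below v k j" if "j < n" for j
    proof -
      have "first_zero_below v k j \<noteq> None" using True that by force
      then show ?thesis using Suc.prems by (auto simp: first_zero_below_def split: if_splits)
    qed
    then have "?r m = ?r k" by simp
    moreover have "passes_op [k..<m] A f (v k) (?r k) = State_Monad.return (?r k)"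
      using True A unfolding upt by simp
    ultimately show ?thesis by (simp only: runs_within_return)
  next
    case False
    \<comment> \<open>For \<open>k > e\<close> the vector is zero and the zeros of
      \<open>v e\<close> are recorded, so the loop would have been left. At \<open>k = e\<close>
      entries may still be unset, whence the extra pass in \<open>Suc e\<close>.\<close>
    have "k \<le> e"
    proof (rule ccontr)
      assume "\<not> k \<le> e"
      then have "v k = 0\<^sub>v n" "\<And>j. j < n \<Longrightarrow> first_zero_below v k j \<noteq> None"
        using zero by (auto simp: first_zero_below_def intro!: exI[of _ e])
      then show False using False by force
    qed
    then have c: "(Suc e - k) * horner_cost n (degree f)
        = horner_cost n (degree f) + (Suc e - Suc k) * horner_cost n (degree f)"
      by (simp add: Suc_diff_le)
    have "runs_within (passes_op [Suc k..<m] A f (v (Suc k)) (?r (Suc k))) (?r m)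
        ((Suc e - Suc k) * horner_cost n (degree f))"
      using Suc.hyps(2) by (intro Suc.hyps(1)) auto
    then show ?thesis
      unfolding c upt using False A
      by (auto simp: record_zeros_first_zero_below step
          intro!: runs_within_bind[OF runs_within_horner_op[OF v A]])
  qed
qed

section \<open>The whole computation for one factor\<close>

text \<open>The terms stand for the \<open>m\<close> divisions, for Horner's rule with the cofactor
  of degree \<open>n - m * d\<close>, and for \<open>e + 1\<close> passes.\<close>

definition factor_cost :: "nat \<Rightarrow> nat \<Rightarrow> nat \<Rightarrow> nat \<Rightarrow> nat" where
  "factor_cost n d m e =
     m * (2 * d * (n + 1)) + (horner_cost n (n - m * d) + Suc e * horner_cost n d)"

text \<open>The two exponents serve different ends: \<open>m\<close> makes the default value
  correct, \<open>e\<close> bounds the number of passes.\<close>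

lemma runs_within_factor_exponents_op:
  assumes A: "A \<in> carrier_mat n n" and u: "u \<in> carrier_vec n"
    and f: "lead_coeff f = 1" and chi: "char_poly A = f ^ m * g"
    and e: "min_poly A dvd f ^ e * g"
  shows "runs_within (factor_exponents_op A (char_poly A) u (f, m))
    (map (\<lambda>j. LEAST k. row_mult u (mat_poly (char_poly A div f ^ m) A * mat_poly f A ^\<^sub>m k) $ j = 0) [0..<n])
    (factor_cost n (degree f) m e)"
proof -
  have f0: "f \<noteq> 0" using f by auto
  have deg: "degree (char_poly A) = n" and chi0: "char_poly A \<noteq> 0"
    using degree_monic_char_poly[OF A] by auto
  then have g0: "g \<noteq> 0" using chi by auto
  have dg: "degree g = n - m * degree f"
    using deg chi f0 g0 by (auto simp: degree_mult_eq degree_power_eq mult.commute)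
  have g: "char_poly A div f ^ m = g" using chi f0 by simp
  define v where "v k = row_mult u (mat_poly g A * mat_poly f A ^\<^sub>m k)" for k
  have G: "mat_poly g A \<in> carrier_mat n n" and F: "mat_poly f A \<in> carrier_mat n n"
    using A by simp_all
  have pow: "mat_poly g A * mat_poly f A ^\<^sub>m k = mat_poly (f ^ k * g) A" for k
    by (simp add: mat_poly_mult[OF A] mat_poly_power[OF A] mult.commute[of _ g])
  have v: "v k \<in> carrier_vec n" for k
    unfolding v_def pow by (rule row_mult_carrier[OF mat_poly_carrier[OF A]])
  have step: "v (Suc k) = row_mult (v k) (mat_poly f A)" for k
  proof -
    have "mat_poly g A * mat_poly f A ^\<^sub>m Suc k = (mat_poly g A * mat_poly f A ^\<^sub>m k) * mat_poly f A"
      using G F by (simp add: assoc_mult_mat[of _ n n _ n _ n])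
    then show ?thesis
      using G F u by (simp add: v_def row_mult_mult[of u n "mat_poly g A * mat_poly f A ^\<^sub>m k"])
  qed
  have ann: "mat_poly (min_poly A) A = 0\<^sub>m n n" using min_poly_spec[OF A] by blast
  \<comment> \<open>Each \<open>v k\<close> is \<open>u\<close> times the value of f^k g at
    \<open>A\<close>, so divisibility by the minimal polynomial makes it vanish. This is used with
    \<open>i = e\<close> for the cost and with \<open>i = m\<close> for the default value.\<close>
  have zero: "v k = 0\<^sub>v n" if "min_poly A dvd f ^ i * g" "i \<le> k" for i k
  proof -
    have "f ^ i * g dvd f ^ k * g" using that(2) by (simp add: le_imp_power_dvd mult_dvd_mono)
    then have "mat_poly (f ^ k * g) A = 0\<^sub>m n n"
      using mat_poly_dvd_eq_0[OF A ann] that(1) dvd_trans by blast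
    then show ?thesis using u by (simp add: v_def pow)
  qed
  have vm: "v m = 0\<^sub>v n"
    using zero[of m m] min_poly_dvd[OF A cayley_hamilton[OF A]] chi by simp
  have v0: "row_mult u (mat_poly g A) = v 0"
    unfolding v_def using G F by simp
  have least: "(case first_zero_below v m j of None \<Rightarrow> m | Some k \<Rightarrow> k) = (LEAST k. v k $ j = 0)"
    if j: "j < n" for j
  proof (cases "\<exists>i<m. v i $ j = 0")
    case True
    then show ?thesis by (simp add: first_zero_below_def)
  next
    case False
    \<comment> \<open>No zero occurs before \<open>m\<close>, and \<open>v m\<close> is zero: an
      unset exponent is exactly \<open>m\<close>.\<close>
    have "(LEAST k. v k $ j = 0) = m"
      using vm j False by (intro Least_equality) (auto simp: not_less[symmetric])
    then show ?thesis using False by (simp add: first_zero_below_def)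
  qed
  have "runs_within (div_monic_power_op (char_poly A) f m) g (m * (2 * degree f * (n + 1)))"
    using runs_within_div_monic_power_op[OF f, of m g] by (simp add: chi[symmetric] deg)
  moreover have "runs_within (horner_op u A (coeffs g)) (v 0) (horner_cost n (n - m * degree f))"
    using runs_within_horner_op[OF u A, of g] by (simp add: dg v0)
  moreover have "runs_within (passes_op [0..<m] A f (v 0) (replicate (dim_row A) None))
      (map (first_zero_below v m) [0..<n]) (Suc e * horner_cost n (degree f))"
  proof -
    have "replicate (dim_row A) None = map (first_zero_below v 0) [0..<n]"
      using A by (intro nth_equalityI) (auto simp: first_zero_below_def)
    then show ?thesis
      using runs_within_passes_op[where v = v and e = e and k = 0 and m = m, OF A v step zero[OF e]] by simp
  qed
  ultimately have "runs_within (factor_exponents_op A (char_poly A) u (f, m))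
     (map (\<lambda>x. case x of None \<Rightarrow> m | Some k \<Rightarrow> k) (map (first_zero_below v m) [0..<n]))
     (factor_cost n (degree f) m e)"
    unfolding factor_exponents_op_def factor_cost_def prod.case
    by (blast intro: runs_within_bind runs_within_bind_return)
  moreover have "map (\<lambda>x. case x of None \<Rightarrow> m | Some k \<Rightarrow> k) (map (first_zero_below v m) [0..<n])
      = map (\<lambda>j. LEAST k. v k $ j = 0) [0..<n]"
    by (simp add: least)
  ultimately show ?thesis by (simp only: g v_def)
qed

text \<open>Lower-order terms are absorbed by n \<le> n^2, n + 1 \<le> 2 n and e + 1 \<le> 2 e. The
  11 consists of 2 * 5 from the passes and 1 from the step below for the cofactor.\<close>

lemma factor_cost_le:
  assumes "1 \<le> n" "1 \<le> d" "1 \<le> e" "m * d \<le> n"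
  shows "factor_cost n d m e \<le> 4 * n^2 * (n - m * d) + 4 * n * (m * d) + 11 * n^2 * (e * d)"
proof -
  have n2: "n \<le> n^2" using assms(1) by (simp add: power2_eq_square)
  then have h: "horner_cost n k \<le> 4 * n^2 * k + n" for k
    using mult_le_mono2[of "2 * n^2 + 2 * n" "4 * n^2" k] by (simp add: horner_cost_def mult.commute)
  have "n \<le> n^2 * d" using n2 assms(2) by (metis le_trans mult_le_mono2 mult.right_neutral)
  then have "horner_cost n d \<le> 5 * n^2 * d" using h[of d] by simp
  then have "Suc e * horner_cost n d \<le> (2 * e) * (5 * n^2 * d)"
    using assms(3) by (intro mult_le_mono) simp_all
  \<comment> \<open>The cofactor may have degree 0, so the additive \<open>n\<close> of its Horner
    cost is charged to the passes.\<close>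
  moreover have "n \<le> n^2 * (e * d)"
    using n2 assms(2,3) mult_le_mono[of n "n^2" 1 "e * d"] by simp
  then have "horner_cost n (n - m * d) \<le> 4 * n^2 * (n - m * d) + n^2 * (e * d)"
    using h[of "n - m * d"] by (meson add_left_mono le_trans)
  moreover have "m * (2 * d * (n + 1)) \<le> 4 * n * (m * d)"
    using mult_le_mono2[of "2 * n + 2" "4 * n" "m * d"] assms(1) by (simp add: algebra_simps)
  ultimately have "factor_cost n d m e \<le> 4 * n * (m * d)
      + ((4 * n^2 * (n - m * d) + n^2 * (e * d)) + (2 * e) * (5 * n^2 * d))"
    unfolding factor_cost_def by (intro add_mono)
  then show ?thesis by (simp add: ac_simps)
qed

text \<open>Dividing by \<open>f\<close> lowers the degree, so splitting off factors
  \<open>f\<close> terminates.\<close>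

lemma ex_exact_power:
  fixes p f :: "'a::field poly"
  assumes "p \<noteq> 0" "1 \<le> degree f"
  shows "\<exists>k h. p = f ^ k * h \<and> \<not> f dvd h"
  using assms(1)
proof (induction "degree p" arbitrary: p rule: less_induct)
  case less
  show ?case
  proof (cases "f dvd p")
    case True
    then obtain r where r: "p = f * r" by (elim dvdE)
    then have "r \<noteq> 0" "f \<noteq> 0" using less.prems by auto
    then have "degree r < degree p" using assms(2) by (simp add: r degree_mult_eq)
    then obtain k h where "r = f ^ k * h" "\<not> f dvd h" using less.hyps \<open>r \<noteq> 0\<close> by blast
    then show ?thesis using r by (intro exI[of _ "Suc k"] exI[of _ h]) (simp add: mult.assoc)
  next
    case False
    then show ?thesis by (intro exI[of _ 0] exI[of _ p]) simp
  qed
qed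

section \<open>Algorithm P\<close>

theorem proposition4:
  shows "\<exists>C > 0 :: real.
    \<forall>(n :: nat) (A :: 'a::field_char_0 mat) (fs :: ('a poly \<times> nat) list) (u :: 'a vec).
      A \<in> carrier_mat n n \<longrightarrow>
      irreducible_factorization (char_poly A) fs \<longrightarrow>
      u \<in> carrier_vec n \<longrightarrow> u \<noteq> 0\<^sub>v n \<longrightarrow>
      (let q = length fs;
           (rho, cost) = run_state (algorithm_P A (char_poly A) fs u) 0
       in length rho = q \<and>
          (\<forall>i<q. length (rho ! i) = n \<and> (\<forall>j<n. rho ! i ! j = pap_exponent A fs u i j)) \<and>
          (\<forall>j<n. (\<Prod>i<q. fst (fs ! i) ^ (rho ! i ! j)) = unit_pap A fs u j) \<and>
          real cost \<le> C * ((real q - 1) * real n ^ 3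
                            + real n ^ 2 * real (degree (min_poly A))))"
proof (intro exI[of _ 15] conjI allI impI)
  fix n :: nat and A :: "'a mat" and fs :: "('a poly \<times> nat) list" and u :: "'a vec"
  assume A: "A \<in> carrier_mat n n" and fs: "irreducible_factorization (char_poly A) fs"
    and u: "u \<in> carrier_vec n" "u \<noteq> 0\<^sub>v n"
  define chi where "chi = char_poly A"
  define \<pi> where "\<pi> = min_poly A"
  define q where "q = length fs"
  \<comment> \<open>The multiplicity of \<open>f\<close> in \<pi>; \<open>ex_exact_power\<close>
    justifies the choice for nonconstant \<open>f\<close>.\<close>
  define e where "e f = (SOME k. \<exists>h. \<pi> = f ^ k * h \<and> \<not> f dvd h)" for f
  define rows where "rows = (\<lambda>(f, m). map (\<lambda>j. LEAST k.
    row_mult u (mat_poly (chi div f ^ m) A * mat_poly f A ^\<^sub>m k) $ j = 0) [0..<n])"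
  \<comment> \<open>In dimension 0 every vector is zero, contrary to the choice of
    \<open>u\<close>.\<close>
  have n: "1 \<le> n"
  proof (rule ccontr)
    assume "\<not> 1 \<le> n"
    then show False using u by (auto intro!: eq_vecI)
  qed
  have deg: "degree chi = n" and chi0: "chi \<noteq> 0"
    using degree_monic_char_poly[OF A] by (auto simp: chi_def)
  have dist: "distinct (map fst fs)" and prod: "chi = (\<Prod>(f, m)\<leftarrow>fs. f ^ m)"
    using fs by (auto simp: irreducible_factorization_def chi_def)
  have irr: "lead_coeff f = 1" "irreducible f" "1 \<le> m" if "(f, m) \<in> set fs" for f m
    using fs that by (auto simp: irreducible_factorization_def)
  have pi0: "\<pi> \<noteq> 0" and ann: "mat_poly \<pi> A = 0\<^sub>m n n"
    using min_poly_spec[OF A] by (auto simp: \<pi>_def)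
  have pi_chi: "\<pi> dvd chi"
    unfolding \<pi>_def chi_def by (rule min_poly_dvd[OF A cayley_hamilton[OF A]])
  have chi_pi: "chi dvd \<pi> ^ n"
    unfolding chi_def by (rule char_poly_dvd_power[OF A ann])
  have factor: "1 \<le> degree f" "f ^ m dvd chi" "1 \<le> e f" "f ^ e f dvd \<pi>" "m * degree f \<le> n"
    "runs_within (factor_exponents_op A chi u (f, m)) (rows (f, m)) (factor_cost n (degree f) m (e f))"
    if fm: "(f, m) \<in> set fs" for f m
  proof -
    have f: "prime_elem f" using irr(2)[OF fm] by (rule field_poly_irreducible_imp_prime)
    have f0: "f \<noteq> 0" and nu: "\<not> is_unit f"
      using f by (rule prime_elem_not_zeroI, rule prime_elem_not_unit)
    show d: "1 \<le> degree f" using is_unit_iff_degree[OF f0] nu by linarith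
    have "f ^ m \<in> set (map (\<lambda>(f, m). f ^ m) fs)" using fm by force
    then show fchi: "f ^ m dvd chi" unfolding prod by (rule prod_list_dvd)
    then obtain g where g: "chi = f ^ m * g" by (elim dvdE)
    have "f dvd f ^ m" using irr(3)[OF fm] by simp
    then have "f dvd \<pi> ^ n" using fchi chi_pi dvd_trans by blast
    then have "f dvd \<pi>" using f prime_elem_dvd_power by blast
    have "\<exists>h. \<pi> = f ^ e f * h \<and> \<not> f dvd h"
      unfolding e_def using ex_exact_power[OF pi0 d] by (rule someI_ex)
    then obtain h where h: "\<pi> = f ^ e f * h" "\<not> f dvd h" by blast
    show "1 \<le> e f"
      using h \<open>f dvd \<pi>\<close> by (cases "e f") auto
    show "f ^ e f dvd \<pi>" using h(1) by simp
    show "m * degree f \<le> n"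
      using dvd_imp_degree_le[OF fchi chi0] f0 deg by (simp add: degree_power_eq mult.commute)
    \<comment> \<open>The \<open>f\<close>-free part \<open>h\<close> of \<pi> divides \<chi>, hence
      already \<open>g\<close>; this gives the divisibility that bounds the number of
      passes.\<close>
    have "h dvd f ^ m * g" using h(1) pi_chi g by (metis dvd_mult_right)
    then have "h dvd g" using prime_elem_coprime_part_dvd[OF f h(2)] by blast
    then have "\<pi> dvd f ^ e f * g" using h(1) by (simp add: mult_dvd_mono)
    then show "runs_within (factor_exponents_op A chi u (f, m)) (rows (f, m))
        (factor_cost n (degree f) m (e f))"
      using runs_within_factor_exponents_op[OF A u(1) irr(1)[OF fm], of m g "e f"] g
      by (simp add: rows_def chi_def \<pi>_def)
  qed
  let ?cost = "\<Sum>(f, m)\<leftarrow>fs. factor_cost n (degree f) m (e f)"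
  have "runs_within (algorithm_P A chi fs u) (map rows fs) ?cost"
    unfolding algorithm_P_def using factor(6) by (intro runs_within_traverse_list) auto
  then obtain cost where cost: "cost \<le> ?cost"
    and run: "run_state (algorithm_P A chi fs u) 0 = (map rows fs, cost)"
    unfolding runs_within_def by (metis add_0)
  have sum_md: "(\<Sum>(f, m)\<leftarrow>fs. m * degree f) = n"
  proof -
    \<comment> \<open>Lists of factors taken from \<open>fs\<close> permit induction while keeping
      the facts about each factor.\<close>
    have "degree (\<Prod>(f, m)\<leftarrow>gs. f ^ m) = (\<Sum>(f, m)\<leftarrow>gs. m * degree f) \<and> (\<Prod>(f, m)\<leftarrow>gs. f ^ m) \<noteq> 0"
      if "set gs \<subseteq> set fs" for gs
      using that
    proof (induction gs)
      case (Cons x gs)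
      obtain f m where x: "x = (f, m)" by force
      have "f \<noteq> 0" using factor(1)[of f m] Cons.prems x by auto
      then show ?case using Cons by (simp add: x degree_mult_eq degree_power_eq)
    qed simp
    from this[of fs] show ?thesis using deg prod by simp
  qed
  have sum_ed: "(\<Sum>(f, m)\<leftarrow>fs. e f * degree f) \<le> degree \<pi>"
  proof -
    have "(\<Prod>f\<leftarrow>map fst fs. f ^ e f) dvd \<pi>"
      using dist irr factor(4) by (intro prod_monic_irreducible_powers_dvd) auto
    then have "degree (\<Prod>f\<leftarrow>map fst fs. f ^ e f) \<le> degree \<pi>"
      using pi0 by (rule dvd_imp_degree_le)
    moreover have "degree (\<Prod>f\<leftarrow>map fst fs. f ^ e f) = (\<Sum>f\<leftarrow>map fst fs. e f * degree f)"
      using factor(1) by (intro degree_prod_list_powers) force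
    ultimately show ?thesis by (simp add: case_prod_unfold comp_def)
  qed
  have "fs \<noteq> []" using sum_md n by auto
  then obtain f m where fm: "(f, m) \<in> set fs" by (cases fs) auto
  have pi1: "1 \<le> degree \<pi>"
  proof -
    have "f dvd f ^ e f" using factor(3)[OF fm] by simp
    then have "f dvd \<pi>" using factor(4)[OF fm] dvd_trans by blast
    then show ?thesis using dvd_imp_degree_le pi0 factor(1)[OF fm] le_trans by blast
  qed
  \<comment> \<open>Over the reals the differences n - m d sum to a difference without truncation;
    for \<open>fs\<close> itself it becomes q n - n, the source of q - 1.\<close>
  have sum_bound: "real (\<Sum>(f, m)\<leftarrow>gs. factor_cost n (degree f) m (e f))
      \<le> 4 * real n ^ 2 * (real (length gs) * real n - real (\<Sum>(f, m)\<leftarrow>gs. m * degree f))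
        + 4 * real n * real (\<Sum>(f, m)\<leftarrow>gs. m * degree f)
        + 11 * real n ^ 2 * real (\<Sum>(f, m)\<leftarrow>gs. e f * degree f)" if "set gs \<subseteq> set fs" for gs
    using that
  proof (induction gs)
    case (Cons x gs)
    obtain f m where x: "x = (f, m)" by force
    then have fm: "(f, m) \<in> set fs" using Cons.prems by simp
    have "real (factor_cost n (degree f) m (e f)) \<le> real (4 * n^2 * (n - m * degree f)
        + 4 * n * (m * degree f) + 11 * n^2 * (e f * degree f))"
      using factor_cost_le[OF n factor(1)[OF fm] factor(3)[OF fm] factor(5)[OF fm]] by (rule of_nat_mono)
    also have "\<dots> = 4 * real n ^ 2 * (real n - real (m * degree f)) + 4 * real n * real (m * degree f)
        + 11 * real n ^ 2 * real (e f * degree f)"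
      using factor(5)[OF fm] by (simp add: of_nat_diff)
    finally show ?case using Cons by (simp add: x algebra_simps)
  qed simp
  have "real cost \<le> 4 * real n ^ 2 * (real q * real n - real n) + 4 * real n * real n
        + 11 * real n ^ 2 * real (degree \<pi>)"
  proof -
    have "real n ^ 2 * real (\<Sum>(f, m)\<leftarrow>fs. e f * degree f) \<le> real n ^ 2 * real (degree \<pi>)"
      using sum_ed by (intro mult_left_mono of_nat_mono) auto
    then show ?thesis using sum_bound[of fs] sum_md cost by (simp add: q_def)
  qed
  \<comment> \<open>The cost of the divisions is absorbed because deg \<pi> \<ge> 1; with the 11 of
    the passes this makes the constant 15.\<close>
  also have "4 * real n * real n \<le> 4 * real n ^ 2 * real (degree \<pi>)"
    using mult_left_mono[of 1 "real (degree \<pi>)" "4 * real n ^ 2"] pi1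
    by (simp add: power2_eq_square mult.assoc)
  also have "4 * real n ^ 2 * (real q * real n - real n) = 4 * ((real q - 1) * real n ^ 3)"
    by (simp add: power2_eq_square power3_eq_cube algebra_simps)
  \<comment> \<open>Enlarging 4 to 15 is sound because q \<ge> 1 makes q - 1 nonnegative.\<close>
  also have "\<dots> \<le> 15 * ((real q - 1) * real n ^ 3)"
    using \<open>fs \<noteq> []\<close> by (intro mult_right_mono) (auto simp: q_def Suc_le_eq)
  finally have bound: "real cost \<le> 15 * ((real q - 1) * real n ^ 3 + real n ^ 2 * real (degree \<pi>))"
    by (simp add: algebra_simps)
  have rows: "length (map rows fs ! i) = n" "j < n \<Longrightarrow> map rows fs ! i ! j = pap_exponent A fs u i j"
    if "i < q" for i j
    using that by (simp_all add: q_def rows_def pap_exponent_def chi_def split: prod.split)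
  then have "(\<Prod>i<q. fst (fs ! i) ^ (map rows fs ! i ! j)) = unit_pap A fs u j" if "j < n" for j
    using that by (simp add: unit_pap_def q_def)
  then show "let q = length fs;
           (rho, cost) = run_state (algorithm_P A (char_poly A) fs u) 0
       in length rho = q \<and>
          (\<forall>i<q. length (rho ! i) = n \<and> (\<forall>j<n. rho ! i ! j = pap_exponent A fs u i j)) \<and>
          (\<forall>j<n. (\<Prod>i<q. fst (fs ! i) ^ (rho ! i ! j)) = unit_pap A fs u j) \<and>
          real cost \<le> 15 * ((real q - 1) * real n ^ 3
                            + real n ^ 2 * real (degree (min_poly A)))"
    using run rows bound unfolding chi_def \<pi>_def q_def Let_def by simp
qed simp

end
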